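(* Let $k$ be a positive integer and let $G$ be a graph that contains none of $K_{1,k}$, $kK_2$ (a matching with $k$ edges) and $2K_{1,k-1}$ (two vertex-disjoint copies of $K_{1,k-1}$) as a subgraph. Then $$e(G)\le g_1(k)=\begin{cases}k^2-\frac32k+\frac12 & k \text{ odd},\\ k^2-\frac32 k & k \text{ even}.\end{cases}$$ Furthermore, up to adding or deleting isolated vertices, equality holds if and only if $G=R(2k-1,k-1)$ when $k$ is odd, and $G=R(2k-1,k-1)$ or $G=R(k+1,k-1)\cup K_{k-1}$ when $k$ is even.
   Context: $e(G)$ is the number of edges of $G$. $R(n,d)$ denotes an almost $d$-regular graph on $n$ vertices, i.e. a graph on $n$ vertices in which all vertices have degree $d$ except at most one vertex of degree $d-1$. $G_1\cup G_2$ denotes disjoint union. *)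

theory Defs
  imports Complex_Main
begin

definition graph :: "'a set \<Rightarrow> 'a set set \<Rightarrow> bool" where
  "graph V E \<longleftrightarrow> finite V \<and> (\<forall>e\<in>E. \<exists>u v. u \<in> V \<and> v \<in> V \<and> u \<noteq> v \<and> e = {u, v})"

definition degree :: "'a set set \<Rightarrow> 'a \<Rightarrow> nat" where
  "degree E v = card {e \<in> E. v \<in> e}"

definition contains_subgraph :: "'b set \<Rightarrow> 'b set set \<Rightarrow> 'a set \<Rightarrow> 'a set set \<Rightarrow> bool" where
  "contains_subgraph VH EH V E \<longleftrightarrow>
     (\<exists>f. inj_on f VH \<and> f ` VH \<subseteq> V \<and> (\<forall>e\<in>EH. f ` e \<in> E))"

definition star_V :: "nat \<Rightarrow> nat set" where "star_V k = {0..k}"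
definition star_E :: "nat \<Rightarrow> nat set set" where "star_E k = {{0, i} | i. i \<in> {1..k}}"

definition matching_V :: "nat \<Rightarrow> nat set" where "matching_V k = {0..<2*k}"
definition matching_E :: "nat \<Rightarrow> nat set set" where
  "matching_E k = {{2*i, 2*i+1} | i. i < k}"

definition two_stars_V :: "nat \<Rightarrow> nat set" where "two_stars_V m = {0..<2*(m+1)}"
definition two_stars_E :: "nat \<Rightarrow> nat set set" where
  "two_stars_E m = {{0, i} | i. i \<in> {1..m}} \<union> {{m+1, m+1+i} | i. i \<in> {1..m}}"

definition almost_regular :: "'a set \<Rightarrow> 'a set set \<Rightarrow> nat \<Rightarrow> nat \<Rightarrow> bool" where
  "almost_regular V E n d \<longleftrightarrow> graph V E \<and> card V = n \<and>
     (\<forall>v\<in>V. degree E v = d \<or> degree E v = d - 1) \<and>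
     card {v\<in>V. degree E v \<noteq> d} \<le> 1"

definition complete_graph :: "'a set \<Rightarrow> 'a set set \<Rightarrow> bool" where
  "complete_graph V E \<longleftrightarrow> finite V \<and> E = {{u, v} | u v. u \<in> V \<and> v \<in> V \<and> u \<noteq> v}"

text \<open>Two graphs are isomorphic up to adding/deleting isolated vertices: the subgraphs
  spanned by the non-isolated vertices (= \<Union>E) are isomorphic.\<close>
definition iso_upto_isolated :: "'a set set \<Rightarrow> 'b set set \<Rightarrow> bool" where
  "iso_upto_isolated E1 E2 \<longleftrightarrow>
     (\<exists>f. bij_betw f (\<Union>E1) (\<Union>E2) \<and>
          (\<forall>u\<in>\<Union>E1. \<forall>v\<in>\<Union>E1. {u, v} \<in> E1 \<longleftrightarrow> {f u, f v} \<in> E2))"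

definition g1 :: "nat \<Rightarrow> real" where
  "g1 k = (if odd k then real k ^ 2 - 3/2 * real k + 1/2 else real k ^ 2 - 3/2 * real k)"

end

theory Submission
  imports Defs
begin

text \<open>
  Put \<open>d = k - 1\<close>, so that the maximum degree and the matching number are at most \<open>d\<close>. Delete
  vertices that lie in every maximum matching, one after the other, until none is left, and let \<open>S\<close>
  be the set of deleted vertices. By Gallai's lemma, ``no maximum matching misses both \<open>u\<close> and \<open>v\<close>''
  is then an equivalence relation containing adjacency; its classes \<open>C\<close> have odd size \<open>2 m\<^sub>C + 1\<close>, and the
  matching number is \<open>|S| + \<Sum> m\<^sub>C \<le> d\<close>. At most \<open>d |S|\<close> edges meet \<open>S\<close>, and a class spans at most
  \<open>m\<^sub>C d\<close> edges if \<open>2 m\<^sub>C < d\<close> and at most \<open>m\<^sub>C d + \<lfloor>d/2\<rfloor>\<close> otherwise. If a single class is of the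
  second kind, the bound \<open>d\<^sup>2 + \<lfloor>d/2\<rfloor>\<close> follows. Two such classes have \<open>d + 1\<close> vertices each, and one of them
  has no vertex of degree \<open>d\<close> because there are no two disjoint stars, so the bound is strict.
  In the case of equality the large class is almost \<open>d\<close>-regular, a vertex of \<open>S\<close> would have degree \<open>d\<close> and
  yield two disjoint stars, and any other nontrivial class is a \<open>K\<^sub>d\<close> with \<open>d\<close> odd.
\<close>

section \<open>Graphs\<close>

lemma graph_edgeE:
  assumes "graph V E" "e \<in> E"
  obtains u v where "e = {u, v}" "u \<noteq> v" "u \<in> V" "v \<in> V"
  using assms unfolding graph_def by blast

lemma graph_edge_card: "graph V E \<Longrightarrow> e \<in> E \<Longrightarrow> card e = 2"
  by (elim graph_edgeE) auto

lemma graph_edge_subset: "graph V E \<Longrightarrow> e \<in> E \<Longrightarrow> e \<subseteq> V"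
  by (elim graph_edgeE) auto

lemma graph_finite_vertices: "graph V E \<Longrightarrow> finite V"
  by (simp add: graph_def)

lemma graph_finite_edges: "graph V E \<Longrightarrow> finite E"
  using graph_edge_subset graph_finite_vertices
  by (metis finite_Pow_iff finite_subset Pow_iff subsetI)

lemma graph_restrict: "graph V E \<Longrightarrow> (\<And>e. e \<in> F \<Longrightarrow> e \<in> E \<and> e \<subseteq> W) \<Longrightarrow> W \<subseteq> V \<Longrightarrow> graph W F"
  unfolding graph_def
  by (metis finite_subset insert_subset)

section \<open>Gallai's lemma and the Gallai--Edmonds partition\<close>

definition matching :: "'a set set \<Rightarrow> 'a set set \<Rightarrow> bool" where
  "matching E M \<longleftrightarrow> M \<subseteq> E \<and> pairwise disjnt M"

definition max_matching :: "'a set set \<Rightarrow> 'a set set \<Rightarrow> bool" where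
  "max_matching E M \<longleftrightarrow> matching E M \<and> (\<forall>M'. matching E M' \<longrightarrow> card M' \<le> card M)"

lemma max_matching_exists:
  assumes "graph V E"
  shows "\<exists>M. max_matching E M"
proof -
  have "matching E {}" by (simp add: matching_def)
  moreover have "\<forall>M. matching E M \<longrightarrow> card M < Suc (card E)"
    using graph_finite_edges[OF assms] by (auto simp: matching_def less_Suc_eq_le card_mono)
  ultimately show ?thesis
    unfolding max_matching_def
    using ex_has_greatest_nat[of "matching E" "{}" card "Suc (card E)"] by blast
qed

lemma card_Union_matching:
  assumes "graph V E" "matching E M"
  shows "card (\<Union>M) = 2 * card M"
proof -
  have "card (\<Union>M) = sum card M"
    using assms by (intro card_Union_disjoint) (auto simp: matching_def elim!: graph_edgeE)
  also have "\<dots> = (\<Sum>e\<in>M. 2)"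
    using assms graph_edge_card[OF assms(1)] by (intro sum.cong) (auto simp: matching_def)
  finally show ?thesis by simp
qed

lemma matching_finite: "graph V E \<Longrightarrow> matching E M \<Longrightarrow> finite M"
  unfolding matching_def using graph_finite_edges finite_subset by blast

lemma matching_Union_subset: "graph V E \<Longrightarrow> matching E M \<Longrightarrow> \<Union>M \<subseteq> V"
  unfolding matching_def using graph_edge_subset by blast

lemma matching_insert:
  assumes "matching E M" "e \<in> E" "e \<inter> \<Union>M = {}"
  shows "matching E (insert e M)"
  using assms unfolding matching_def pairwise_insert disjnt_def by blast

text \<open>The disjunct \<open>u = v\<close> is there for reflexivity: a vertex that some maximum
  matching misses would otherwise fail to be related to itself.\<close>

definition never_both_missed :: "'a set set \<Rightarrow> 'a \<Rightarrow> 'a \<Rightarrow> bool" where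
  "never_both_missed E u v \<longleftrightarrow> u = v \<or> (\<forall>M. max_matching E M \<longrightarrow> u \<in> \<Union>M \<or> v \<in> \<Union>M)"

text \<open>The core of Gallai's lemma. The hypothesis on \<open>w\<close> supplies the matchings
  that are compared with a supposed maximum matching missing both \<open>u\<close> and
  \<open>v\<close>.\<close>

lemma never_both_missed_trans:
  assumes G: "graph V E"
    and w: "\<exists>M. max_matching E M \<and> w \<notin> \<Union>M"
    and uw: "never_both_missed E u w" and wv: "never_both_missed E w v"
  shows "never_both_missed E u v"
proof (rule ccontr)
  assume "\<not> never_both_missed E u v"
  then obtain M where M: "max_matching E M" "u \<notin> \<Union>M" "v \<notin> \<Union>M" and "u \<noteq> v"
    unfolding never_both_missed_def by blast
  have "u \<noteq> w" "w \<noteq> v"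
    using uw wv M \<open>u \<noteq> v\<close> unfolding never_both_missed_def by blast+
  \<comment> \<open>Among the maximum matchings missing \<open>w\<close>, one sharing the most edges with \<open>M\<close> could be
    exchanged along a path of length two to share one edge more.\<close>
  let ?Q = "\<lambda>N. max_matching E N \<and> w \<notin> \<Union>N"
  obtain N0 where N0: "?Q N0" using w by blast
  have finM: "finite M" using M matching_finite[OF G] max_matching_def by blast
  have "\<forall>N. ?Q N \<longrightarrow> card (M \<inter> N) < Suc (card M)"
    using finM by (auto simp: less_Suc_eq_le intro: card_mono)
  then obtain N where N: "?Q N" and Nmax: "\<And>N'. ?Q N' \<Longrightarrow> card (M \<inter> N') \<le> card (M \<inter> N)"
    using ex_has_greatest_nat[of ?Q N0 "\<lambda>N. card (M \<inter> N)" "Suc (card M)"] N0 by blast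
  have mM: "matching E M" and mN: "matching E N" and cMN: "card M = card N"
    using M N unfolding max_matching_def by (auto intro: antisym)
  have finN: "finite N" using mN matching_finite[OF G] by blast
  have uvN: "{u, v} \<subseteq> \<Union>N - \<Union>M"
    using uw wv N M \<open>u \<noteq> w\<close> \<open>w \<noteq> v\<close> unfolding never_both_missed_def by blast
  have fU: "finite (\<Union>M)" "finite (\<Union>N)"
    using matching_Union_subset[OF G] mM mN graph_finite_vertices[OF G] finite_subset by blast+
  \<comment> \<open>Both matchings cover equally many vertices, and \<open>N\<close> covers the two
    vertices \<open>u\<close> and \<open>v\<close> that \<open>M\<close> misses. So \<open>M\<close>
    covers at least two vertices that \<open>N\<close> misses, and one of them is not
    \<open>w\<close>.\<close>
  have "card (\<Union>M) = card (\<Union>N)"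
    using card_Union_matching[OF G] mM mN cMN by simp
  then have "card (\<Union>M - \<Union>N) = card (\<Union>N - \<Union>M)"
    using fU by (simp add: card_Diff_subset_Int Int_commute)
  also have "\<dots> \<ge> 2"
    using card_mono[OF _ uvN] fU \<open>u \<noteq> v\<close> by simp
  finally have "\<not> \<Union>M - \<Union>N \<subseteq> {w}"
    using card_mono[of "{w}" "\<Union>M - \<Union>N"] by auto
  then obtain x e where x: "x \<in> e" "e \<in> M" "x \<notin> \<Union>N" "x \<noteq> w" by blast
  have eE: "e \<in> E" using x mM by (auto simp: matching_def)
  have "e \<inter> \<Union>N \<noteq> {}"
  proof
    assume "e \<inter> \<Union>N = {}"
    then have "matching E (insert e N)" by (rule matching_insert[OF mN eE])
    moreover have "e \<notin> N" using x by blast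
    ultimately show False using N finN unfolding max_matching_def by fastforce
  qed
  then obtain y n where y: "y \<in> e" "y \<in> n" "n \<in> N" by blast
  have "x \<noteq> y" using x y by blast
  then have e: "e = {x, y}"
    using x y graph_edgeE[OF G eE] by (metis insert_iff insert_commute singletonD)
  have enN: "e \<notin> N" "n \<notin> M"
    using x y mM unfolding matching_def pairwise_def disjnt_def by blast+
  \<comment> \<open>The exchange keeps the number of edges and still misses \<open>w\<close>:
    \<open>x\<close> was chosen different from \<open>w\<close>, and \<open>y\<close> was already
    covered by \<open>N\<close>. The edge gained lies in \<open>M\<close>, the edge lost does
    not.\<close>
  let ?N' = "insert e (N - {n})"
  have "matching E (N - {n})" using mN by (auto simp: matching_def pairwise_def)
  moreover have "e \<inter> \<Union>(N - {n}) = {}"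
    using e x y mN unfolding matching_def pairwise_def disjnt_def by blast
  ultimately have mN': "matching E ?N'" using eE by (intro matching_insert)
  have "card ?N' = card N"
    using enN finN y card_Suc_Diff1[of N n] by simp
  then have "max_matching E ?N'" using N mN' unfolding max_matching_def by simp
  moreover have "w \<notin> \<Union>?N'" using N e x y by blast
  ultimately have "card (M \<inter> ?N') \<le> card (M \<inter> N)" using Nmax by blast
  moreover have "M \<inter> ?N' = insert e (M \<inter> N)" using enN x by blast
  ultimately show False using enN finM by simp
qed

text \<open>No edge joins two classes, since a maximum matching missing both its ends could be
  enlarged by it. A maximum matching misses at most one vertex of each class and otherwise matches
  the class within itself. One that misses a given vertex of the class shows that the class is odd,
  and therefore every maximum matching misses exactly one vertex of it.\<close>

lemma gallai_partition:
  assumes G: "graph V E"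
    and missed: "\<And>v. v \<in> V \<Longrightarrow> \<exists>M. max_matching E M \<and> v \<notin> \<Union>M"
  shows "\<exists>P M. \<Union>P = V \<and> pairwise disjnt P \<and> (\<forall>C\<in>P. odd (card C)) \<and>
    (\<forall>e\<in>E. \<exists>C\<in>P. e \<subseteq> C) \<and> max_matching E M \<and> card M = (\<Sum>C\<in>P. card C div 2)"
proof -
  define R where "R = {(u, v). u \<in> V \<and> v \<in> V \<and> never_both_missed E u v}"
  define P where "P = V // R"
  have equiv: "equiv V R"
  proof (rule equivI)
    show "R \<subseteq> V \<times> V" by (auto simp: R_def)
    show "refl_on V R" by (auto simp: R_def refl_on_def never_both_missed_def)
    show "sym R" by (auto simp: R_def sym_def never_both_missed_def)
    show "trans R"
      unfolding trans_def R_def using never_both_missed_trans[OF G missed] by blast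
  qed
  have finV: "finite V" using G by (rule graph_finite_vertices)
  have UP: "\<Union>P = V" unfolding P_def using equiv by (rule Union_quotient)
  have dP: "pairwise disjnt P"
    unfolding P_def pairwise_def disjnt_def using quotient_disj[OF equiv] by blast
  have finP: "finite P" using UP finV by (simp add: finite_UnionD)
  have finC: "finite C" if "C \<in> P" for C using that UP finV by (metis Union_upper finite_subset)
  have eP: "\<exists>C\<in>P. e \<subseteq> C" if "e \<in> E" for e
  proof -
    obtain u v where uv: "e = {u, v}" "u \<noteq> v" "u \<in> V" "v \<in> V" using graph_edgeE[OF G \<open>e \<in> E\<close>] .
    have "never_both_missed E u v"
      unfolding never_both_missed_def
    proof (rule disjI2, intro allI impI)
      fix M assume M: "max_matching E M"
      show "u \<in> \<Union>M \<or> v \<in> \<Union>M"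
      proof (rule ccontr)
        assume "\<not> ?thesis"
        then have "e \<inter> \<Union>M = {}" "e \<notin> M" using uv by auto
        moreover have "finite M" using M matching_finite[OF G] max_matching_def by blast
        ultimately show False
          using M that matching_insert[of E M e] unfolding max_matching_def by fastforce
      qed
    qed
    then have "(u, v) \<in> R" using uv by (simp add: R_def)
    then have "e \<subseteq> R `` {u}" using uv equiv by (auto simp: equiv_def refl_on_def)
    then show ?thesis using uv by (auto simp: P_def quotient_def)
  qed
  have disjC: "C = D" if "C \<in> P" "D \<in> P" "z \<in> C" "z \<in> D" for C D z
    using dP that unfolding pairwise_def disjnt_def by blast
  have one_missed: "x = y"
    if "max_matching E M" "C \<in> P" "x \<in> C" "y \<in> C" "x \<notin> \<Union>M" "y \<notin> \<Union>M" for M C x y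
  proof -
    have "(x, y) \<in> R" using that equiv quotient_eq_iff[OF equiv] unfolding P_def by blast
    then show ?thesis using that unfolding R_def never_both_missed_def by blast
  qed
  \<comment> \<open>An edge of \<open>M\<close> that meets \<open>C\<close> lies inside
    \<open>C\<close>, so the covered part of \<open>C\<close> is a union of disjoint pairs.\<close>
  have covered: "card (C \<inter> \<Union>M) = 2 * card {e \<in> M. e \<subseteq> C}" if M: "matching E M" and C: "C \<in> P" for M C
  proof -
    have "C \<inter> \<Union>M = \<Union>{e \<in> M. e \<subseteq> C}"
    proof -
      have "e \<subseteq> C" if "e \<in> M" "x \<in> e" "x \<in> C" for e x
      proof -
        obtain D where "D \<in> P" "e \<subseteq> D" using eP M \<open>e \<in> M\<close> unfolding matching_def by blast
        then show ?thesis using disjC[of C D x] that C by blast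
      qed
      then show ?thesis by blast
    qed
    moreover have "matching E {e \<in> M. e \<subseteq> C}"
      using M unfolding matching_def pairwise_def by blast
    ultimately show ?thesis using card_Union_matching[OF G] by metis
  qed
  have oddC: "odd (card C)" if C: "C \<in> P" for C
  proof -
    obtain v where v: "v \<in> C" using C equiv in_quotient_imp_non_empty unfolding P_def by fastforce
    then obtain M where M: "max_matching E M" "v \<notin> \<Union>M" using missed C UP by blast
    have "C \<inter> \<Union>M = C - {v}" using one_missed[OF M(1) C] v M(2) by blast
    then have "card (C - {v}) = 2 * card {e \<in> M. e \<subseteq> C}"
      using covered[OF _ C] M(1) max_matching_def by metis
    then show ?thesis using v finC[OF C] card_Suc_Diff1[of C v] by (metis even_Suc even_mult_iff even_numeral)
  qed
  obtain M where M: "max_matching E M" using max_matching_exists[OF G] by blast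
  then have mM: "matching E M" by (simp add: max_matching_def)
  have half: "card C div 2 = card {e \<in> M. e \<subseteq> C}" if C: "C \<in> P" for C
  proof -
    \<comment> \<open>At most one vertex is missed, the covered ones are even in number and
      \<open>card C\<close> is odd: exactly one is missed.\<close>
    have "card (C - \<Union>M) \<le> 1"
      using one_missed[OF M C] finC[OF C] by (auto simp: card_le_Suc0_iff_eq)
    moreover have "card C = card (C \<inter> \<Union>M) + card (C - \<Union>M)"
      using finC[OF C] by (metis card_Diff_subset_Int card_mono finite_Int inf_le1 le_add_diff_inverse)
    ultimately show ?thesis using oddC[OF C] covered[OF mM C] by presburger
  qed
  have "M = (\<Union>C\<in>P. {e \<in> M. e \<subseteq> C})" using eP mM unfolding matching_def by blast
  also have "card \<dots> = (\<Sum>C\<in>P. card {e \<in> M. e \<subseteq> C})"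
  proof (rule card_UN_disjoint)
    show "\<forall>C\<in>P. finite {e \<in> M. e \<subseteq> C}" using matching_finite[OF G mM] by simp
    show "\<forall>C\<in>P. \<forall>D\<in>P. C \<noteq> D \<longrightarrow> {e \<in> M. e \<subseteq> C} \<inter> {e \<in> M. e \<subseteq> D} = {}"
    proof (intro ballI impI, rule ccontr)
      fix C D assume *: "C \<in> P" "D \<in> P" "C \<noteq> D" "{e \<in> M. e \<subseteq> C} \<inter> {e \<in> M. e \<subseteq> D} \<noteq> {}"
      then obtain e where "e \<in> M" "e \<subseteq> C" "e \<subseteq> D" by blast
      moreover have "e \<noteq> {}" using \<open>e \<in> M\<close> mM graph_edge_card[OF G, of e] by (auto simp: matching_def)
      ultimately show False using disjC * by blast
    qed
  qed (rule finP)
  also have "\<dots> = (\<Sum>C\<in>P. card C div 2)" using half by simp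
  finally show ?thesis using UP dP oddC eP M by blast
qed

text \<open>Induction on the number of vertices. Deleting a vertex that every maximum matching
  covers lowers the matching number by exactly one, which pays for putting it into \<open>S\<close>.
  Once no such vertex is left, Gallai's lemma applies. The result is a witness for equality in the
  Tutte-Berge formula.\<close>

theorem gallai_edmonds_partition:
  assumes "graph V E"
  shows "\<exists>S P M. S \<subseteq> V \<and> \<Union>P = V - S \<and> pairwise disjnt P \<and> (\<forall>C\<in>P. odd (card C)) \<and>
    (\<forall>e\<in>E. e \<inter> S = {} \<longrightarrow> (\<exists>C\<in>P. e \<subseteq> C)) \<and>
    max_matching E M \<and> card M = card S + (\<Sum>C\<in>P. card C div 2)"
  using assms
proof (induction "card V" arbitrary: V E rule: less_induct)
  case less
  note G = \<open>graph V E\<close>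
  show ?case
  proof (cases "\<forall>v\<in>V. \<exists>M. max_matching E M \<and> v \<notin> \<Union>M")
    case True
    then have missed: "\<exists>M. max_matching E M \<and> v \<notin> \<Union>M" if "v \<in> V" for v using that by blast
    obtain P M where "\<Union>P = V" "pairwise disjnt P" "\<forall>C\<in>P. odd (card C)"
      "\<forall>e\<in>E. \<exists>C\<in>P. e \<subseteq> C" "max_matching E M" "card M = (\<Sum>C\<in>P. card C div 2)"
      using gallai_partition[OF G missed] by blast
    then show ?thesis by (intro exI[of _ "{}"] exI[of _ P] exI[of _ M]) simp
  next
    case False
    then obtain v where v: "v \<in> V" "\<And>M. max_matching E M \<Longrightarrow> v \<in> \<Union>M" by blast
    let ?E = "{e \<in> E. v \<notin> e}"
    have finV: "finite V" using G by (rule graph_finite_vertices)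
    have G': "graph (V - {v}) ?E"
      by (rule graph_restrict[OF G]) (use graph_edge_subset[OF G] in auto)
    have smaller: "card (V - {v}) < card V" using v finV by (intro psubset_card_mono) auto
    obtain S P M where SPM: "S \<subseteq> V - {v}" "\<Union>P = V - {v} - S" "pairwise disjnt P"
      "\<forall>C\<in>P. odd (card C)" "\<forall>e\<in>?E. e \<inter> S = {} \<longrightarrow> (\<exists>C\<in>P. e \<subseteq> C)"
      "max_matching ?E M" "card M = card S + (\<Sum>C\<in>P. card C div 2)"
      using less.hyps[OF smaller G'] by (elim exE conjE)
    obtain N where N: "max_matching E N" using max_matching_exists[OF G] by blast
    then have mN: "matching E N" by (simp add: max_matching_def)
    have finN: "finite N" using matching_finite[OF G mN] .
    \<comment> \<open>The matching number does drop: \<open>M\<close> is also a matching of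
      \<open>E\<close>, but it misses \<open>v\<close>, so it is not maximum there.\<close>
    have "matching E M" "v \<notin> \<Union>M" using SPM(6) by (auto simp: max_matching_def matching_def)
    then have "card M < card N"
      using v(2)[of M] N unfolding max_matching_def by (meson le_trans not_le)
    obtain e where e: "e \<in> N" "v \<in> e" using v(2)[OF N] by blast
    \<comment> \<open>It drops by no more than one: \<open>N\<close> without its edge at
      \<open>v\<close> survives the deletion.\<close>
    have "matching ?E (N - {e})"
      using mN e unfolding matching_def pairwise_def disjnt_def by blast
    then have "card (N - {e}) \<le> card M" using SPM(6) by (auto simp: max_matching_def)
    then have "card N = Suc (card M)"
      using \<open>card M < card N\<close> e finN by simp
    moreover have "card (insert v S) = Suc (card S)"
      using SPM(1) finite_subset[OF SPM(1)] finV by (subst card_insert_disjoint) auto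
    moreover have "\<forall>e\<in>E. e \<inter> insert v S = {} \<longrightarrow> (\<exists>C\<in>P. e \<subseteq> C)" using SPM(5) by blast
    moreover have "\<Union>P = V - insert v S" using SPM(2) by blast
    moreover have "insert v S \<subseteq> V" using SPM(1) v(1) by blast
    ultimately show ?thesis using SPM(3,4,7) N
      by (intro exI[of _ "insert v S"] exI[of _ P] exI[of _ N]) simp
  qed
qed

section \<open>Degrees and edge counts\<close>

definition nbhd :: "'a set set \<Rightarrow> 'a \<Rightarrow> 'a set" where
  "nbhd E v = {u. {v, u} \<in> E}"

definition induced :: "'a set set \<Rightarrow> 'a set \<Rightarrow> 'a set set" where
  "induced E C = {e \<in> E. e \<subseteq> C}"

lemma induced_graph: "graph V E \<Longrightarrow> C \<subseteq> V \<Longrightarrow> graph C (induced E C)"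
  by (rule graph_restrict) (auto simp: induced_def)

lemma not_in_nbhd_self: "graph V E \<Longrightarrow> v \<notin> nbhd E v"
  using graph_edge_card by (fastforce simp: nbhd_def)

lemma nbhd_subset: "graph V E \<Longrightarrow> nbhd E v \<subseteq> V"
  using graph_edge_subset by (fastforce simp: nbhd_def)

lemma nbhd_finite: "graph V E \<Longrightarrow> finite (nbhd E v)"
  using nbhd_subset graph_finite_vertices finite_subset by metis

lemma nbhd_mono: "F \<subseteq> E \<Longrightarrow> nbhd F v \<subseteq> nbhd E v"
  by (auto simp: nbhd_def)

lemma degree_eq_card_nbhd:
  assumes "graph V E"
  shows "degree E v = card (nbhd E v)"
proof -
  have "bij_betw (\<lambda>u. {v, u}) (nbhd E v) {e \<in> E. v \<in> e}"
    unfolding bij_betw_def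
  proof
    show "inj_on (\<lambda>u. {v, u}) (nbhd E v)" by (auto simp: inj_on_def doubleton_eq_iff)
    show "(\<lambda>u. {v, u}) ` nbhd E v = {e \<in> E. v \<in> e}"
    proof
      show "{e \<in> E. v \<in> e} \<subseteq> (\<lambda>u. {v, u}) ` nbhd E v"
      proof
        fix e assume e: "e \<in> {e \<in> E. v \<in> e}"
        then obtain a b where "e = {a, b}" using graph_edgeE[OF assms] by blast
        then have "e = {v, a} \<or> e = {v, b}" using e by auto
        then show "e \<in> (\<lambda>u. {v, u}) ` nbhd E v" using e by (auto simp: nbhd_def)
      qed
    qed (auto simp: nbhd_def)
  qed
  then show ?thesis by (simp add: degree_def bij_betw_same_card)
qed

lemma degree_mono: "graph V E \<Longrightarrow> F \<subseteq> E \<Longrightarrow> degree F v \<le> degree E v"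
  unfolding degree_def by (rule card_mono) (auto dest: graph_finite_edges)

lemma degree_less_card:
  assumes "graph V E" "v \<in> V"
  shows "degree E v \<le> card V - 1"
proof -
  have "nbhd E v \<subseteq> V - {v}" using nbhd_subset not_in_nbhd_self assms by fastforce
  then have "card (nbhd E v) \<le> card (V - {v})"
    using graph_finite_vertices[OF assms(1)] by (intro card_mono) auto
  then show ?thesis using assms by (simp add: degree_eq_card_nbhd)
qed

lemma sum_degrees:
  assumes "graph V E"
  shows "(\<Sum>v\<in>V. degree E v) = 2 * card E"
proof -
  have fin: "finite V" "finite E"
    using assms graph_finite_vertices graph_finite_edges by blast+
  have "(\<Sum>v\<in>V. degree E v) = (\<Sum>v\<in>V. \<Sum>e\<in>E. if v \<in> e then 1 else 0)"
    using fin by (simp add: degree_def sum.If_cases Int_def)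
  also have "\<dots> = (\<Sum>e\<in>E. \<Sum>v\<in>V. if v \<in> e then 1 else 0)" by (rule sum.swap)
  also have "\<dots> = (\<Sum>e\<in>E. card e)"
  proof (rule sum.cong)
    fix e assume "e \<in> E"
    then have "V \<inter> e = e" using graph_edge_subset[OF assms] by blast
    then show "(\<Sum>v\<in>V. if v \<in> e then 1 else 0) = card e" using fin by (simp add: sum.If_cases)
  qed simp
  also have "\<dots> = 2 * card E" using graph_edge_card[OF assms] by simp
  finally show ?thesis .
qed

section \<open>Edge counts under a degree bound, and their equality cases\<close>

lemma degree_le_imp_card_edges_le:
  assumes "graph V E" "\<And>v. v \<in> V \<Longrightarrow> degree E v \<le> d"
  shows "2 * card E \<le> card V * d"
  using sum_bounded_above[of V "degree E" d] assms sum_degrees[OF assms(1)] by simp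

text \<open>The deficiencies \<open>d - degree E v\<close> add up to
  \<open>card V * d - 2 * card E\<close>, which is at most 1. Hence at most one vertex falls short
  of \<open>d\<close>, and only by one.\<close>

lemma almost_regularI:
  assumes G: "graph V E" and d: "\<And>v. v \<in> V \<Longrightarrow> degree E v \<le> d"
    and e: "card V * d \<le> 2 * card E + 1"
  shows "almost_regular V E (card V) d"
proof -
  have fin: "finite V" using G by (rule graph_finite_vertices)
  have "(\<Sum>v\<in>V. d - degree E v) + (\<Sum>v\<in>V. degree E v) = (\<Sum>v\<in>V. d)"
    unfolding sum.distrib[symmetric] using d by (intro sum.cong) auto
  then have s: "(\<Sum>v\<in>V. d - degree E v) \<le> 1" using e sum_degrees[OF G] by simp
  have "degree E v = d \<or> degree E v = d - 1" if "v \<in> V" for v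
  proof -
    have "d - degree E v \<le> (\<Sum>v\<in>V. d - degree E v)"
      using member_le_sum[of v V "\<lambda>v. d - degree E v"] that fin by simp
    then show ?thesis using s d[OF that] by linarith
  qed
  moreover have "card {v \<in> V. degree E v \<noteq> d} \<le> (\<Sum>v\<in>V. d - degree E v)"
  proof -
    have "card {v \<in> V. degree E v \<noteq> d} = (\<Sum>v\<in>V. if degree E v \<noteq> d then 1 else 0)"
      using fin by (simp add: sum.If_cases Int_def)
    also have "\<dots> \<le> (\<Sum>v\<in>V. d - degree E v)"
      using d by (intro sum_mono) (fastforce simp: le_less)
    finally show ?thesis .
  qed
  ultimately show ?thesis using G s unfolding almost_regular_def by auto
qed

text \<open>The number of deficient vertices is 0 or 1 and has the parity of \<open>n * d\<close>,
  so rounding down gives the exact count.\<close>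

lemma almost_regular_card_edges:
  assumes "almost_regular V E n d"
  shows "card E = n * d div 2"
proof -
  have G: "graph V E" and n: "card V = n"
    and deg: "\<And>v. v \<in> V \<Longrightarrow> degree E v = d \<or> degree E v = d - 1"
    and D: "card {v \<in> V. degree E v \<noteq> d} \<le> 1"
    using assms by (auto simp: almost_regular_def)
  have fin: "finite V" using G by (rule graph_finite_vertices)
  have "n * d = (\<Sum>v\<in>V. d)" using n by simp
  also have "\<dots> = (\<Sum>v\<in>V. degree E v + (if degree E v \<noteq> d then 1 else 0))"
    using deg by (intro sum.cong) fastforce+
  also have "\<dots> = 2 * card E + card {v \<in> V. degree E v \<noteq> d}"
    using fin by (simp add: sum.distrib sum_degrees[OF G] sum.If_cases Int_def)
  finally show ?thesis using D by presburger
qed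

lemma complete_graphI:
  assumes G: "graph V E" and e: "card V * (card V - 1) \<le> 2 * card E"
  shows "complete_graph V E"
proof -
  have fin: "finite V" using G by (rule graph_finite_vertices)
  have deg: "degree E v = card V - 1" if "v \<in> V" for v
  proof (rule ccontr)
    assume "degree E v \<noteq> card V - 1"
    then have "degree E v < card V - 1" using degree_less_card[OF G that] by simp
    then have "(\<Sum>v\<in>V. degree E v) < (\<Sum>v\<in>V. card V - 1)"
      using degree_less_card[OF G] fin that by (intro sum_strict_mono_ex1) auto
    then show False using e sum_degrees[OF G] by simp
  qed
  have "{u, v} \<in> E" if "u \<in> V" "v \<in> V" "u \<noteq> v" for u v
  proof -
    have "nbhd E u \<subseteq> V - {u}" using nbhd_subset[OF G] not_in_nbhd_self[OF G] by fastforce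
    moreover have "card (nbhd E u) = card (V - {u})"
      using deg[OF that(1)] degree_eq_card_nbhd[OF G] that fin by simp
    ultimately have "nbhd E u = V - {u}" using fin by (intro card_subset_eq) auto
    then show ?thesis using that by (auto simp: nbhd_def)
  qed
  then show ?thesis using G unfolding complete_graph_def graph_def by blast
qed

lemma complete_graph_graph: "complete_graph V E \<Longrightarrow> graph V E"
  unfolding complete_graph_def graph_def by blast

lemma complete_graph_card_edges:
  assumes "complete_graph V E"
  shows "2 * card E = card V * (card V - 1)"
proof -
  have G: "graph V E" using assms by (rule complete_graph_graph)
  have "degree E v = card V - 1" if "v \<in> V" for v
  proof -
    have "nbhd E v = V - {v}"
      using assms that by (auto simp: nbhd_def complete_graph_def doubleton_eq_iff)
    then show ?thesis
      using that degree_eq_card_nbhd[OF G] graph_finite_vertices[OF G] by simp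
  qed
  then show ?thesis using sum_degrees[OF G] by simp
qed

text \<open>Two degree bounds compete: the given \<open>d\<close> and the trivial
  \<open>2 * m\<close>. The trivial one is better when \<open>2 * m < d\<close> and gives at most
  \<open>m * (2 * m + 1)\<close> edges. Reaching \<open>m * d\<close> then forces
  \<open>d = 2 * m + 1\<close> with all pairs present. A single vertex (\<open>m = 0\<close>)
  reaches \<open>m * d\<close> for every \<open>d\<close>, which is why the equality case excludes
  it.\<close>

lemma odd_class_card_edges:
  assumes G: "graph C F" and C: "card C = 2 * m + 1" and d: "\<And>v. v \<in> C \<Longrightarrow> degree F v \<le> d"
  shows "card F \<le> m * d + d div 2"
    and "2 * m < d \<Longrightarrow> card F \<le> m * d"
    and "2 * m < d \<Longrightarrow> m \<noteq> 0 \<Longrightarrow> card F = m * d \<Longrightarrow> d = 2 * m + 1 \<and> complete_graph C F"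
proof -
  have "2 * card F \<le> (2 * m + 1) * d" using degree_le_imp_card_edges_le[OF G d] C by simp
  then show "card F \<le> m * d + d div 2" by (simp add: algebra_simps)
  have "2 * card F \<le> (2 * m + 1) * (2 * m)"
    using degree_le_imp_card_edges_le[OF G degree_less_card[OF G]] C by simp
  then have F: "card F \<le> m * (2 * m + 1)" by (simp add: algebra_simps)
  show "card F \<le> m * d" if "2 * m < d"
  proof -
    have "m * (2 * m + 1) \<le> m * d" using that by (intro mult_le_mono) auto
    then show ?thesis using F by linarith
  qed
  show "d = 2 * m + 1 \<and> complete_graph C F" if "2 * m < d" "m \<noteq> 0" "card F = m * d"
  proof
    have "m * d \<le> m * (2 * m + 1)" using F that(3) by (simp only:)
    then have "d \<le> 2 * m + 1" using that(2) by (simp only: mult_le_cancel1)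
    then show "d = 2 * m + 1" using that(1) by simp
    then show "complete_graph C F" using that(3) C by (intro complete_graphI[OF G]) simp
  qed
qed

section \<open>Forbidden subgraphs\<close>

text \<open>Centres and leaf sets replace embeddings of the numbered pattern, so that the extremal
  argument works with neighbourhoods only.\<close>

definition disjoint_stars :: "'a set set \<Rightarrow> nat \<Rightarrow> bool" where
  "disjoint_stars E m \<longleftrightarrow> (\<exists>s w A B. A \<subseteq> nbhd E s \<and> B \<subseteq> nbhd E w \<and>
     card A = m \<and> card B = m \<and> insert s A \<inter> insert w B = {})"

lemma disjoint_starsI:
  "A \<subseteq> nbhd E s \<Longrightarrow> B \<subseteq> nbhd E w \<Longrightarrow> card A = m \<Longrightarrow> card B = m \<Longrightarrow>
    insert s A \<inter> insert w B = {} \<Longrightarrow> disjoint_stars E m"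
  unfolding disjoint_stars_def by (intro exI conjI)

section \<open>From vertex sets and matchings to embeddings of the forbidden patterns\<close>

lemma contains_starI:
  assumes G: "graph V E" and k: "1 \<le> k" "k \<le> degree E v"
  shows "contains_subgraph (star_V k) (star_E k) V E"
proof -
  have "k \<le> card (nbhd E v)" using k degree_eq_card_nbhd[OF G] by simp
  then obtain A where A: "A \<subseteq> nbhd E v" "card A = k" "finite A"
    by (meson obtain_subset_with_card_n)
  obtain h where h: "bij_betw h {1..k} A"
    using ex_bij_betw_nat_finite_1[OF A(3)] A(2) by blast
  let ?f = "\<lambda>i. if i = 0 then v else h i"
  have hA: "h i \<in> A" if "i \<in> {1..k}" for i using h that bij_betwE by blast
  have vA: "v \<notin> A" using A not_in_nbhd_self[OF G] by blast
  \<comment> \<open>\<open>nbhd\<close> does not confine its vertex to \<open>V\<close>. An edge at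
    \<open>v\<close>, available because of \<open>1 \<le> k\<close>, does.\<close>
  have "A \<noteq> {}" using A k by auto
  then obtain u where "{v, u} \<in> E" using A unfolding nbhd_def by blast
  then have "v \<in> V" using graph_edge_subset[OF G] by blast
  have S: "star_V k = insert 0 {1..k}" by (auto simp: star_V_def)
  have hinj: "i = j" if "h i = h j" "i \<in> {1..k}" "j \<in> {1..k}" for i j
    using inj_onD[OF bij_betw_imp_inj_on[OF h]] that by blast
  have "inj_on ?f (star_V k)"
  proof (rule inj_onI)
    fix i j assume "i \<in> star_V k" "j \<in> star_V k" "?f i = ?f j"
    then show "i = j"
      using hinj[of i j] hA[of i] hA[of j] vA by (auto simp: star_V_def split: if_splits)
  qed
  moreover have "?f ` star_V k \<subseteq> V"
  proof -
    have "A \<subseteq> V" using A(1) nbhd_subset[OF G] by blast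
    then show ?thesis using hA \<open>v \<in> V\<close> unfolding S by auto
  qed
  moreover have "\<forall>e\<in>star_E k. ?f ` e \<in> E"
  proof
    fix e assume "e \<in> star_E k"
    then obtain i where i: "e = {0, i}" "i \<in> {1..k}" by (auto simp: star_E_def)
    then have "?f ` e = {v, h i}" by auto
    then show "?f ` e \<in> E" using hA[OF i(2)] A(1) unfolding nbhd_def by auto
  qed
  ultimately show ?thesis unfolding contains_subgraph_def by blast
qed

lemma contains_two_starsI:
  assumes G: "graph V E" and m: "1 \<le> m" and stars: "disjoint_stars E m"
  shows "contains_subgraph (two_stars_V m) (two_stars_E m) V E"
proof -
  obtain s w A B where AB: "A \<subseteq> nbhd E s" "B \<subseteq> nbhd E w" "card A = m" "card B = m"
    and disj: "insert s A \<inter> insert w B = {}"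
    using stars unfolding disjoint_stars_def by blast
  have fin: "finite A" "finite B" using AB m by (auto intro!: card_ge_0_finite)
  obtain h where h: "bij_betw h {1..m} A" using ex_bij_betw_nat_finite_1[OF fin(1)] AB(3) by blast
  obtain g where g: "bij_betw g {1..m} B" using ex_bij_betw_nat_finite_1[OF fin(2)] AB(4) by blast
  have hA: "h i \<in> A" if "i \<in> {1..m}" for i using h that bij_betwE by blast
  have gB: "g i \<in> B" if "i \<in> {1..m}" for i using g that bij_betwE by blast
  have hinj: "i = j" if "h i = h j" "i \<in> {1..m}" "j \<in> {1..m}" for i j
    using inj_onD[OF bij_betw_imp_inj_on[OF h]] that by blast
  have ginj: "i = j" if "g i = g j" "i \<in> {1..m}" "j \<in> {1..m}" for i j
    using inj_onD[OF bij_betw_imp_inj_on[OF g]] that by blast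
  have nA: "s \<notin> A" "w \<notin> B" using AB not_in_nbhd_self[OF G] by blast+
  have "A \<noteq> {}" "B \<noteq> {}" using AB m by auto
  then obtain a b where "{s, a} \<in> E" "{w, b} \<in> E" using AB unfolding nbhd_def by blast
  then have V: "s \<in> V" "w \<in> V" using graph_edge_subset[OF G] by blast+
  have VAB: "A \<subseteq> V" "B \<subseteq> V" using AB nbhd_subset[OF G] by blast+
  \<comment> \<open>The pattern numbers its stars \<open>0..m\<close> and \<open>m+1..2*m+1\<close>,
    each with its least number as centre. Hence the shift by \<open>m + 1\<close>.\<close>
  let ?p = "\<lambda>i. if i = 0 then s else h i" and ?q = "\<lambda>i. if i = 0 then w else g i"
  define f where "f i = (if i \<le> m then ?p i else ?q (i - (m + 1)))" for i
  have p: "?p i \<in> insert s A" if "i \<le> m" for i using hA that by auto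
  have q: "?q i \<in> insert w B" if "i \<le> m" for i using gB that by auto
  have pinj: "i = j" if "?p i = ?p j" "i \<le> m" "j \<le> m" for i j
    using that hinj[of i j] hA[of i] hA[of j] nA by (auto split: if_splits)
  have qinj: "i = j" if "?q i = ?q j" "i \<le> m" "j \<le> m" for i j
    using that ginj[of i j] gB[of i] gB[of j] nA by (auto split: if_splits)
  have "inj_on f (two_stars_V m)"
  proof (rule inj_onI)
    fix i j assume ij: "i \<in> two_stars_V m" "j \<in> two_stars_V m" "f i = f j"
    then have lt: "i - (m + 1) \<le> m" "j - (m + 1) \<le> m" by (auto simp: two_stars_V_def)
    consider "i \<le> m" "j \<le> m" | "i \<le> m" "\<not> j \<le> m" | "\<not> i \<le> m" "j \<le> m" | "\<not> i \<le> m" "\<not> j \<le> m"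
      by blast
    then show "i = j"
    proof cases
      case 1 then show ?thesis using ij(3) pinj[of i j] unfolding f_def by simp
    next
      case 2
      then have "f i \<in> insert s A" "f j \<in> insert w B"
        using p[of i] q[OF lt(2)] unfolding f_def by simp_all
      then show ?thesis using ij(3) disj by (metis IntI empty_iff)
    next
      case 3
      then have "f j \<in> insert s A" "f i \<in> insert w B"
        using p[of j] q[OF lt(1)] unfolding f_def by simp_all
      then show ?thesis using ij(3) disj by (metis IntI empty_iff)
    next
      case 4
      then have "i - (m + 1) = j - (m + 1)" using ij(3) lt unfolding f_def by (intro qinj) simp_all
      then show ?thesis using 4 by simp
    qed
  qed
  moreover have "f ` two_stars_V m \<subseteq> V"
  proof
    fix x assume "x \<in> f ` two_stars_V m"
    then obtain i where i: "i \<in> two_stars_V m" "x = f i" by blast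
    then have "i - (m + 1) \<le> m" by (auto simp: two_stars_V_def)
    then have "x \<in> insert s A \<union> insert w B"
      using p[of i] q[of "i - (m + 1)"] i(2) unfolding f_def by (cases "i \<le> m") (auto split: if_splits)
    then show "x \<in> V" using V VAB by blast
  qed
  moreover have "\<forall>e\<in>two_stars_E m. f ` e \<in> E"
  proof
    fix e assume "e \<in> two_stars_E m"
    then consider i where "e = {0, i}" "i \<in> {1..m}" | i where "e = {m+1, m+1+i}" "i \<in> {1..m}"
      unfolding two_stars_E_def by blast
    then show "f ` e \<in> E"
    proof cases
      case 1
      then have "f ` e = {s, h i}" by (auto simp: f_def)
      then show ?thesis using hA[OF 1(2)] AB unfolding nbhd_def by auto
    next
      case 2
      then have "f ` e = {w, g i}" by (auto simp: f_def)
      then show ?thesis using gB[OF 2(2)] AB unfolding nbhd_def by auto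
    qed
  qed
  ultimately show ?thesis unfolding contains_subgraph_def by blast
qed

lemma contains_matchingI:
  assumes G: "graph V E" and M: "matching E M" and k: "k \<le> card M"
  shows "contains_subgraph (matching_V k) (matching_E k) V E"
proof -
  obtain h where h: "bij_betw h {0..<card M} M"
    using ex_bij_betw_nat_finite[OF matching_finite[OF G M]] by blast
  have hM: "h i \<in> M" if "i < k" for i
    using h that k by (auto simp: bij_betw_def)
  then have hE: "h i \<in> E" if "i < k" for i using that M unfolding matching_def by blast
  have hdisj: "i = j" if "i < k" "j < k" "z \<in> h i" "z \<in> h j" for i j z
  proof -
    have "h i = h j"
      using hM[of i] hM[of j] that M unfolding matching_def pairwise_def disjnt_def by blast
    then show ?thesis using h that k by (auto simp: bij_betw_def inj_on_def)
  qed
  have "\<forall>i. \<exists>u v. i < k \<longrightarrow> h i = {u, v} \<and> u \<noteq> v" using hE graph_edgeE[OF G] by metis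
  then obtain a b where ab: "\<And>i. i < k \<Longrightarrow> h i = {a i, b i}" "\<And>i. i < k \<Longrightarrow> a i \<noteq> b i" by metis
  \<comment> \<open>Pattern vertices \<open>2*i\<close> and \<open>2*i+1\<close> go to the two ends
    of the edge \<open>h i\<close>. Disjointness of the edges recovers \<open>i div 2\<close> from
    the image, and \<open>a i \<noteq> b i\<close> recovers the parity.\<close>
  define f where "f i = (if even i then a (i div 2) else b (i div 2))" for i
  have fh: "f i \<in> h (i div 2)" if "i < 2 * k" for i using ab(1)[of "i div 2"] that by (simp add: f_def)
  have "inj_on f (matching_V k)"
  proof (rule inj_onI)
    fix i j assume "i \<in> matching_V k" "j \<in> matching_V k" and eq: "f i = f j"
    then have lt: "i < 2 * k" "j < 2 * k" by (auto simp: matching_V_def)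
    then have half: "i div 2 = j div 2" using fh[OF lt(1)] fh[OF lt(2)] eq hdisj[of "i div 2" "j div 2" "f i"] by auto
    then have "even i = even j"
      using eq ab(2)[of "j div 2"] lt unfolding f_def by (auto split: if_splits)
    then show "i = j" using half by presburger
  qed
  moreover have "f ` matching_V k \<subseteq> V"
  proof
    fix x assume "x \<in> f ` matching_V k"
    then obtain i where i: "i < 2 * k" "x = f i" by (auto simp: matching_V_def)
    then have "h (i div 2) \<subseteq> V" using hE[of "i div 2"] graph_edge_subset[OF G] by simp
    then show "x \<in> V" using fh[OF i(1)] i(2) by blast
  qed
  moreover have "\<forall>e\<in>matching_E k. f ` e \<in> E"
  proof
    fix e assume "e \<in> matching_E k"
    then obtain i where i: "i < k" "e = {2*i, 2*i+1}" by (auto simp: matching_E_def)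
    then have "f ` e = h i" using ab(1) by (simp add: f_def insert_commute)
    then show "f ` e \<in> E" using hE i by simp
  qed
  ultimately show ?thesis unfolding contains_subgraph_def by blast
qed

text \<open>A vertex with \<open>d\<close> neighbours inside \<open>B\<close> has no neighbour
  outside, so \<open>s\<close> is adjacent to no vertex of \<open>B\<close> except possibly the
  deficient one. A vertex \<open>w\<close> of full degree in \<open>B\<close> that is not adjacent
  to a deficient neighbour of \<open>s\<close> then has its whole star disjoint from the star at
  \<open>s\<close>.\<close>

lemma disjoint_stars_of_almost_regular_class:
  assumes G: "graph V E" and deg: "\<And>v. degree E v \<le> d"
    and B: "B \<subseteq> V" and R: "almost_regular B (induced E B) n d" and dn: "1 \<le> d" "d < n"
    and s: "s \<notin> B" "degree E s = d"
  shows "disjoint_stars E d"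
proof -
  let ?F = "induced E B"
  have GF: "graph B ?F" by (rule induced_graph[OF G B])
  have FE: "?F \<subseteq> E" by (auto simp: induced_def)
  have finB: "finite B" using GF by (rule graph_finite_vertices)
  define D where "D = {v \<in> B. degree ?F v \<noteq> d}"
  have cD: "card D \<le> 1" and cB: "card B = n" using R by (auto simp: almost_regular_def D_def)
  have finD: "finite D" using finB by (simp add: D_def)
  have sD: "nbhd E s \<inter> B \<subseteq> D"
  proof
    fix b assume b: "b \<in> nbhd E s \<inter> B"
    then have "s \<in> nbhd E b" by (simp add: nbhd_def insert_commute)
    moreover have "s \<notin> nbhd ?F b" using s by (simp add: nbhd_def induced_def)
    ultimately have "nbhd ?F b \<subset> nbhd E b" using nbhd_mono[OF FE] by blast
    then have "degree ?F b < degree E b"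
      using degree_eq_card_nbhd[OF G] degree_eq_card_nbhd[OF GF] nbhd_finite[OF G]
      by (simp add: psubset_card_mono)
    then have "degree ?F b < d" using deg[of b] by simp
    then show "b \<in> D" using b by (simp add: D_def)
  qed
  obtain w where w: "w \<in> B" "w \<notin> D" "nbhd ?F w \<inter> nbhd E s = {}"
  proof (cases "nbhd E s \<inter> B = {}")
    case True
    have "\<not> B \<subseteq> D" using card_mono[OF finD, of B] cD cB dn by auto
    moreover have "nbhd ?F w \<inter> nbhd E s = {}" for w using True nbhd_subset[OF GF] by blast
    ultimately show ?thesis using that by blast
  next
    case False
    then obtain b where b: "b \<in> nbhd E s" "b \<in> B" by blast
    then have "b \<in> D" using sD by blast
    then have D: "D = {b}" using cD finD card_le_Suc0_iff_eq[of D] by auto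
    have "degree ?F b < d"
      using \<open>b \<in> D\<close> degree_mono[OF G FE, of b] deg[of b] by (simp add: D_def)
    \<comment> \<open>Together with its neighbours in \<open>B\<close>, the deficient vertex
      \<open>b\<close> accounts for at most \<open>d < n\<close> vertices of \<open>B\<close>, so a
      suitable \<open>w\<close> remains.\<close>
    then have "card (insert b (nbhd ?F b)) \<le> d"
      using degree_eq_card_nbhd[OF GF, of b] card_insert_le_m1[of d "nbhd ?F b" b] dn by simp
    then have "\<not> B \<subseteq> insert b (nbhd ?F b)"
      using card_mono[of "insert b (nbhd ?F b)" B] nbhd_finite[OF GF, of b] cB dn by auto
    then obtain w where w: "w \<in> B" "w \<noteq> b" "w \<notin> nbhd ?F b" by blast
    have "b \<notin> nbhd ?F w" using w by (simp add: nbhd_def insert_commute)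
    moreover have "nbhd ?F w \<inter> nbhd E s \<subseteq> {b}" using nbhd_subset[OF GF, of w] sD D by blast
    ultimately show ?thesis using that[of w] w D by blast
  qed
  have "w \<notin> nbhd E s" using w sD by blast
  moreover have "s \<notin> nbhd ?F w" using nbhd_subset[OF GF] s by blast
  ultimately have "insert s (nbhd E s) \<inter> insert w (nbhd ?F w) = {}" using w s by blast
  moreover have "card (nbhd ?F w) = d" using w degree_eq_card_nbhd[OF GF, of w] by (simp add: D_def)
  moreover have "card (nbhd E s) = d" using s degree_eq_card_nbhd[OF G, of s] by simp
  ultimately show ?thesis using disjoint_starsI[OF order_refl nbhd_mono[OF FE]] by metis
qed

section \<open>The extremal problem\<close>

text \<open>The equality part starts at \<open>d = 2\<close>: for \<open>d = 1\<close>, a single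
  edge on a two-element \<open>V\<close> attains the bound, although \<open>V\<close> has no subset
  of \<open>2 * d + 1\<close> vertices. In the first alternative \<open>almost_regular B E\<close>
  refers to all of \<open>E\<close>, so that every vertex outside \<open>B\<close> is
  isolated.\<close>

theorem card_edges_bounded_matching:
  assumes G: "graph V E" and d: "1 \<le> d" and deg: "\<And>v. degree E v \<le> d"
    and nu: "\<forall>M. matching E M \<longrightarrow> card M \<le> d" and ns: "\<not> disjoint_stars E d"
  shows "card E \<le> d * d + d div 2"
    and "2 \<le> d \<Longrightarrow> card E = d * d + d div 2 \<Longrightarrow>
      (\<exists>B\<subseteq>V. almost_regular B E (2 * d + 1) d) \<or>
      (odd d \<and> (\<exists>B C. B \<subseteq> V \<and> C \<subseteq> V \<and> B \<inter> C = {} \<and> almost_regular B (induced E B) (d + 2) d \<and>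
        complete_graph C (induced E C) \<and> card C = d \<and> E = induced E B \<union> induced E C))"
proof -
  obtain S P M where SV: "S \<subseteq> V" and UP: "\<Union>P = V - S" and dP: "pairwise disjnt P"
    and oddP: "\<forall>C\<in>P. odd (card C)"
    and edges: "\<forall>e\<in>E. e \<inter> S = {} \<longrightarrow> (\<exists>C\<in>P. e \<subseteq> C)"
    and M: "max_matching E M" "card M = card S + (\<Sum>C\<in>P. card C div 2)"
    using gallai_edmonds_partition[OF G] by (elim exE conjE)
  define m :: "'a set \<Rightarrow> nat" where "m C = card C div 2" for C
  let ?F = "induced E"
  have finV: "finite V" using G by (rule graph_finite_vertices)
  have finS: "finite S" using SV finV finite_subset by blast
  have finE: "finite E" using G by (rule graph_finite_edges)
  have finP: "finite P" using UP finV by (metis finite_Diff finite_UnionD)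
  have disjP: "C \<inter> D = {}" if "C \<in> P" "D \<in> P" "C \<noteq> D" for C D
    using dP that unfolding pairwise_def disjnt_def by blast
  have CV: "C \<subseteq> V" if "C \<in> P" for C using UP that by blast
  have cC: "card C = 2 * m C + 1" if "C \<in> P" for C using oddP that by (simp add: m_def)
  have GC: "graph C (?F C)" if "C \<in> P" for C by (rule induced_graph[OF G CV[OF that]])
  have FE: "?F C \<subseteq> E" for C by (auto simp: induced_def)
  have degC: "degree (?F C) v \<le> d" for C v
    by (rule le_trans[OF degree_mono[OF G FE] deg])
  have bound: "card (?F C) \<le> m C * d + d div 2" if "C \<in> P" for C
    by (rule odd_class_card_edges(1)[OF GC cC degC]) (rule that)+
  have small: "card (?F C) \<le> m C * d" if "C \<in> P" "2 * m C < d" for C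
    by (rule odd_class_card_edges(2)[OF GC cC degC]) (rule that)+
  have sm: "card S + sum m P \<le> d"
    using nu[rule_format, of M] M by (simp add: max_matching_def m_def)
  have sm_d: "card S * d + sum m P * d \<le> d * d"
    using mult_le_mono1[OF sm, of d] by (simp add: algebra_simps)
  define T where "T = {e \<in> E. e \<inter> S \<noteq> {}}"
  \<comment> \<open>The bound on \<open>card T\<close> is kept as two inequalities because the
    equality case needs the degree sum over \<open>S\<close> itself.\<close>
  have T1: "card T \<le> (\<Sum>s\<in>S. degree E s)"
  proof -
    have "T = (\<Union>s\<in>S. {e \<in> E. s \<in> e})" by (auto simp: T_def)
    then show ?thesis unfolding degree_def using card_UN_le[OF finS] by metis
  qed
  have T2: "(\<Sum>s\<in>S. degree E s) \<le> card S * d"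
    using sum_bounded_above[of S "degree E" d] deg by simp
  have cE: "card E \<le> card T + (\<Sum>C\<in>P. card (?F C))"
  proof -
    have "E = T \<union> (\<Union>C\<in>P. ?F C)"
      using edges by (auto simp: T_def induced_def)
    then have "card E \<le> card T + card (\<Union>C\<in>P. ?F C)" using card_Un_le by metis
    also have "card (\<Union>C\<in>P. ?F C) \<le> (\<Sum>C\<in>P. card (?F C))" by (rule card_UN_le[OF finP])
    finally show ?thesis by simp
  qed
  have split: "(\<Sum>C\<in>P. f C) = f B + (\<Sum>C\<in>P - {B}. f C)" if "B \<in> P" for B and f :: "'a set \<Rightarrow> nat"
    using sum.remove[OF finP that] .
  have sum_small: "(\<Sum>C\<in>Q. card (?F C)) \<le> sum m Q * d"
    if "\<And>C. C \<in> Q \<Longrightarrow> card (?F C) \<le> m C * d" for Q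
    unfolding sum_distrib_right using that by (rule sum_mono)
  \<comment> \<open>A class \<open>C\<close> with \<open>d \<le> 2 * m C\<close> may exceed \<open>m C * d\<close> edges, by at most \<open>d div 2\<close>; all others
    may not. The next three facts treat zero, two and one such classes.\<close>
  have none: "card E \<le> d * d" if "\<And>C. C \<in> P \<Longrightarrow> 2 * m C < d"
    using sum_small[of P] small that cE T1 T2 sm_d by fastforce
  have two: "card E < d * d + d div 2"
    if B: "A \<in> P" "B \<in> P" "A \<noteq> B" "d \<le> 2 * m A" "d \<le> 2 * m B" for A B
  proof -
    have BA: "B \<in> P - {A}" using B by blast
    have split2: "(\<Sum>C\<in>P. f C) = f A + f B + (\<Sum>C\<in>P - {A} - {B}. f C)" for f :: "'a set \<Rightarrow> nat"
      using split[OF B(1), of f] sum.remove[OF _ BA, of f] finP by simp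
    \<comment> \<open>Two large classes exhaust the matching budget \<open>d\<close>: each has
      exactly \<open>d + 1\<close> vertices, \<open>S\<close> is empty and all other classes are
      single vertices.\<close>
    have m2: "2 * m A = d" "2 * m B = d" and rest: "sum m (P - {A} - {B}) = 0"
      using sm split2[of m] B by linarith+
    have "m C = 0" if "C \<in> P - {A} - {B}" for C using rest that finP by simp
    then have "2 * m C < d" if "C \<in> P - {A} - {B}" for C using d that by simp
    then have rest_edges: "(\<Sum>C\<in>P - {A} - {B}. card (?F C)) \<le> 0"
      using sum_small[of "P - {A} - {B}"] small rest by simp
    \<comment> \<open>On \<open>d + 1\<close> vertices of degree at most \<open>d - 1\<close> there
      are at most half of \<open>(d + 1) * (d - 1)\<close> edges, which is less than half of
      \<open>d * d\<close>.\<close>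
    have low: "card (?F C) < m C * d"
      if C: "C \<in> P" "2 * m C = d" and lt: "\<And>v. v \<in> C \<Longrightarrow> degree (?F C) v \<noteq> d" for C
    proof -
      have "degree (?F C) v \<le> d - 1" if "v \<in> C" for v using lt[OF that] degC[of C v] by simp
      then have "2 * card (?F C) \<le> (d + 1) * (d - 1)"
        using degree_le_imp_card_edges_le[OF GC[OF C(1)], of "d - 1"] cC[OF C(1)] C(2) by simp
      also have "\<dots> < d * d" using d by (cases d) auto
      also have "\<dots> = 2 * (m C * d)" using C(2) by simp
      finally show ?thesis by simp
    qed
    have "(\<forall>v\<in>A. degree (?F A) v \<noteq> d) \<or> (\<forall>v\<in>B. degree (?F B) v \<noteq> d)"
    proof (rule ccontr)
      assume "\<not> ?thesis"
      then obtain s w where sw: "s \<in> A" "degree (?F A) s = d" "w \<in> B" "degree (?F B) w = d"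
        by blast
      have "insert s (nbhd (?F A) s) \<subseteq> A" "insert w (nbhd (?F B) w) \<subseteq> B"
        using nbhd_subset[OF GC] B sw by blast+
      then have "insert s (nbhd (?F A) s) \<inter> insert w (nbhd (?F B) w) = {}"
        using disjP[OF B(1-3)] by blast
      moreover have "card (nbhd (?F A) s) = d" "card (nbhd (?F B) w) = d"
        using sw degree_eq_card_nbhd[OF GC[OF B(1)]] degree_eq_card_nbhd[OF GC[OF B(2)]] by simp_all
      ultimately have "disjoint_stars E d"
        using disjoint_starsI[OF nbhd_mono[OF FE] nbhd_mono[OF FE]] by metis
      then show False using ns by contradiction
    qed
    then have "card (?F A) + card (?F B) < m A * d + m B * d + d div 2"
    proof
      assume "\<forall>v\<in>A. degree (?F A) v \<noteq> d"
      then have "card (?F A) < m A * d" using low[OF B(1) m2(1)] by blast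
      then show ?thesis using bound[OF B(2)] by linarith
    next
      assume "\<forall>v\<in>B. degree (?F B) v \<noteq> d"
      then have "card (?F B) < m B * d" using low[OF B(2) m2(2)] by blast
      then show ?thesis using bound[OF B(1)] by linarith
    qed
    moreover have "m A * d + m B * d = d * d"
    proof -
      have "m A + m B = d" using m2 by simp
      then show ?thesis by (metis add_mult_distrib)
    qed
    moreover have "card S = 0" using sm split2[of m] m2 by linarith
    ultimately show ?thesis
      using cE split2[of "\<lambda>C. card (?F C)"] rest_edges T1 T2 by simp
  qed
  have one: "card E \<le> d * d + d div 2"
    "card E = d * d + d div 2 \<Longrightarrow> card (?F B) = m B * d + d div 2 \<and>
      (\<Sum>s\<in>S. degree E s) = card S * d \<and> card S + sum m P = d \<and>
      (\<Sum>C\<in>P - {B}. card (?F C)) = sum m (P - {B}) * d"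
    if B: "B \<in> P" and oth: "\<And>C. C \<in> P - {B} \<Longrightarrow> 2 * m C < d" for B
  proof -
    have Q: "(\<Sum>C\<in>P - {B}. card (?F C)) \<le> sum m (P - {B}) * d"
      using small oth by (intro sum_small) blast
    have sP: "sum m P * d = m B * d + sum m (P - {B}) * d"
      using split[OF B, of m] by (simp add: algebra_simps)
    \<comment> \<open>These inequalities add up to the bound. If it is attained, each of them is
      tight.\<close>
    note facts = cE split[OF B, of "\<lambda>C. card (?F C)"] T1 T2 sm_d sP Q bound[OF B]
    show "card E \<le> d * d + d div 2" using facts by linarith
    assume e: "card E = d * d + d div 2"
    have "card S * d + sum m P * d = d * d" using facts e by linarith
    then have "(card S + sum m P) * d = d * d" by (simp add: algebra_simps)
    then have "card S + sum m P = d" using d by simp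
    moreover have "card (?F B) = m B * d + d div 2" "(\<Sum>s\<in>S. degree E s) = card S * d"
      "(\<Sum>C\<in>P - {B}. card (?F C)) = sum m (P - {B}) * d"
      using facts e by linarith+
    ultimately show "card (?F B) = m B * d + d div 2 \<and>
      (\<Sum>s\<in>S. degree E s) = card S * d \<and> card S + sum m P = d \<and>
      (\<Sum>C\<in>P - {B}. card (?F C)) = sum m (P - {B}) * d" by blast
  qed
  have class_cases: "(\<forall>C\<in>P. 2 * m C < d) \<or> (\<exists>B\<in>P. d \<le> 2 * m B \<and> (\<forall>C\<in>P - {B}. 2 * m C < d)) \<or>
    (\<exists>A\<in>P. \<exists>B\<in>P. A \<noteq> B \<and> d \<le> 2 * m A \<and> d \<le> 2 * m B)"
    unfolding not_le[symmetric] by blast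
  show "card E \<le> d * d + d div 2"
    using class_cases
  proof (elim disjE bexE conjE)
    assume "\<forall>C\<in>P. 2 * m C < d"
    then show ?thesis using none by fastforce
  next
    fix B assume "B \<in> P" "\<forall>C\<in>P - {B}. 2 * m C < d"
    then show ?thesis using one(1)[of B] by blast
  next
    fix A B assume "A \<in> P" "B \<in> P" "A \<noteq> B" "d \<le> 2 * m A" "d \<le> 2 * m B"
    then show ?thesis using two[of A B] by simp
  qed
  assume d2: "2 \<le> d" and e: "card E = d * d + d div 2"
  \<comment> \<open>A positive surplus is what rules out the case without a large class, where
    \<open>d * d\<close> bounds the edges. Two large classes are ruled out by strictness.\<close>
  have "0 < d div 2" using d2 by simp
  then obtain B where B: "B \<in> P" "d \<le> 2 * m B" and oth: "\<And>C. C \<in> P - {B} \<Longrightarrow> 2 * m C < d"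
  proof -
    have "\<not> (\<forall>C\<in>P. 2 * m C < d)" using none e \<open>0 < d div 2\<close> by fastforce
    then show thesis using that class_cases two e by (metis less_irrefl)
  qed
  have eB: "card (?F B) = m B * d + d div 2" and eS: "(\<Sum>s\<in>S. degree E s) = card S * d"
    and total: "card S + sum m P = d"
    and eQ: "(\<Sum>C\<in>P - {B}. card (?F C)) = sum m (P - {B}) * d"
    using one(2)[OF B(1) oth e] by blast+
  have regB: "almost_regular B (?F B) (card B) d"
  proof (rule almost_regularI[OF GC[OF B(1)] degC])
    have "card B * d = 2 * (m B * d) + d" using cC[OF B(1)] by simp
    then show "card B * d \<le> 2 * card (?F B) + 1" using eB by linarith
  qed
  have S0: "S = {}"
  proof (rule ccontr)
    assume "S \<noteq> {}"
    then obtain s where s: "s \<in> S" by blast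
    have "degree E s = d"
    proof (rule ccontr)
      assume "degree E s \<noteq> d"
      then have "degree E s < d" using deg[of s] by simp
      then have "(\<Sum>s\<in>S. degree E s) < (\<Sum>s\<in>S. d)"
        using s deg finS by (intro sum_strict_mono_ex1) auto
      then show False using eS by simp
    qed
    moreover have "s \<notin> B" using s B(1) UP by blast
    moreover have "d < card B" using cC[OF B(1)] B(2) by simp
    ultimately have "disjoint_stars E d"
      using disjoint_stars_of_almost_regular_class[OF G deg CV[OF B(1)] regB d] by blast
    then show False using ns by blast
  qed
  have nontrivial: "m C \<noteq> 0" if "e \<in> E" "e \<subseteq> C" "C \<in> P" for e C
  proof -
    have "finite C" using CV[OF that(3)] finV finite_subset by blast
    then have "2 \<le> card C" using card_mono[OF _ that(2)] graph_edge_card[OF G that(1)] by simp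
    then show ?thesis using cC[OF that(3)] by simp
  qed
  \<comment> \<open>With \<open>S\<close> empty, every edge lies in a class, and the single-vertex
    classes are isolated vertices.\<close>
  have E_eq: "E = \<Union> (?F ` {C \<in> P. m C \<noteq> 0})"
  proof
    show "E \<subseteq> \<Union> (?F ` {C \<in> P. m C \<noteq> 0})"
    proof
      fix e assume e: "e \<in> E"
      then obtain C where "C \<in> P" "e \<subseteq> C" using edges S0 by auto
      then show "e \<in> \<Union> (?F ` {C \<in> P. m C \<noteq> 0})"
        using e nontrivial[of e C] by (auto simp: induced_def)
    qed
  qed (auto simp: induced_def)
  have mB0: "m B \<noteq> 0" using B(2) d2 by simp
  have total_B: "m B + sum m (P - {B}) = d" using total S0 split[OF B(1), of m] by simp
  show "(\<exists>B\<subseteq>V. almost_regular B E (2 * d + 1) d) \<or>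
      (odd d \<and> (\<exists>B C. B \<subseteq> V \<and> C \<subseteq> V \<and> B \<inter> C = {} \<and> almost_regular B (induced E B) (d + 2) d \<and>
        complete_graph C (induced E C) \<and> card C = d \<and> E = induced E B \<union> induced E C))"
  proof (cases "\<exists>C\<in>P - {B}. m C \<noteq> 0")
    case False
    then have classes: "{D \<in> P. m D \<noteq> 0} = {B}" using mB0 B(1) by blast
    have "\<Union> (?F ` {D \<in> P. m D \<noteq> 0}) = ?F B" unfolding classes by simp
    then have "E = ?F B" by (rule trans[OF E_eq])
    moreover have "card B = 2 * d + 1" using False total_B cC[OF B(1)] by simp
    ultimately have "almost_regular B E (2 * d + 1) d" using regB by simp
    then show ?thesis using CV[OF B(1)] by blast
  next
    case True
    then obtain C where C: "C \<in> P - {B}" "m C \<noteq> 0" by blast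
    then have CP: "C \<in> P" "C \<noteq> B" by auto
    have "card (?F C) = m C * d"
    proof (rule sum_mono_inv[of "\<lambda>C. card (?F C)" "P - {B}" "\<lambda>C. m C * d"])
      show "(\<Sum>C\<in>P - {B}. card (?F C)) = (\<Sum>C\<in>P - {B}. m C * d)"
        using eQ by (simp add: sum_distrib_right)
    qed (use small oth C finP in auto)
    then have dC: "d = 2 * m C + 1" and compl: "complete_graph C (?F C)"
      using odd_class_card_edges(3)[OF GC cC degC] CP oth[OF C(1)] C(2) by blast+
    \<comment> \<open>Now \<open>d\<close> is odd and \<open>m C\<close> is
      \<open>(d - 1) / 2\<close>, while \<open>d \<le> 2 * m B\<close> gives \<open>m B\<close> at
      least \<open>(d + 1) / 2\<close>. The budget \<open>d\<close> is thereby used up: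
      \<open>B\<close> has exactly \<open>d + 2\<close> vertices and all other classes are
      trivial.\<close>
    have "sum m (P - {B}) = m C + sum m (P - {B} - {C})"
      using sum.remove[OF _ C(1), of m] finP by simp
    moreover have "m C < m B" using dC B(2) by simp
    ultimately have mB: "2 * m B = d + 1" and rest: "sum m (P - {B} - {C}) = 0"
      using total_B dC by linarith+
    have "D \<in> P \<and> m D \<noteq> 0 \<longleftrightarrow> D = B \<or> D = C" for D
      using rest finP mB0 B(1) C(2) CP(1) by (cases "D = B"; cases "D = C") auto
    then have classes: "{D \<in> P. m D \<noteq> 0} = {B, C}" by blast
    have "\<Union> (?F ` {D \<in> P. m D \<noteq> 0}) = ?F B \<union> ?F C" unfolding classes by simp
    then have E_BC: "E = ?F B \<union> ?F C" by (rule trans[OF E_eq])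
    have "card B = d + 2" using mB cC[OF B(1)] by simp
    then have regB': "almost_regular B (?F B) (d + 2) d" using regB by simp
    have "card C = d" using dC cC[OF CP(1)] by simp
    moreover have "odd d" using dC by simp
    moreover have "B \<inter> C = {}" using disjP[OF B(1) CP(1)] CP(2) by blast
    ultimately show ?thesis
      using regB' compl CV[OF B(1)] CV[OF CP(1)] E_BC
      by (intro disjI2 conjI exI[of _ B] exI[of _ C])
  qed
qed

section \<open>Relabelling\<close>

text \<open>The extremal graphs of the final statement live on natural numbers, whereas the
  structure found so far lives inside \<open>V\<close>. Injections transport the one to the
  other.\<close>

lemma graph_image:
  assumes "graph W E" "inj_on g W"
  shows "graph (g ` W) ((`) g ` E)"
  unfolding graph_def
proof
  show "finite (g ` W)" using graph_finite_vertices[OF assms(1)] by simp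
  show "\<forall>e\<in>(`) g ` E. \<exists>u v. u \<in> g ` W \<and> v \<in> g ` W \<and> u \<noteq> v \<and> e = {u, v}"
  proof
    fix e' assume "e' \<in> (`) g ` E"
    then obtain e where e: "e \<in> E" "e' = g ` e" by blast
    obtain u v where uv: "e = {u, v}" "u \<noteq> v" "u \<in> W" "v \<in> W" using graph_edgeE[OF assms(1) e(1)] .
    then have "g u \<noteq> g v" "e' = {g u, g v}" using assms(2) e(2) by (auto dest: inj_onD)
    then show "\<exists>u v. u \<in> g ` W \<and> v \<in> g ` W \<and> u \<noteq> v \<and> e' = {u, v}" using uv by blast
  qed
qed

lemma degree_image:
  assumes G: "graph W E" and g: "inj_on g W" and v: "v \<in> W"
  shows "degree ((`) g ` E) (g v) = degree E v"
proof -
  have sub: "e \<subseteq> W" if "e \<in> E" for e using graph_edge_subset[OF G that] .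
  have "{e \<in> (`) g ` E. g v \<in> e} = (`) g ` {e \<in> E. v \<in> e}"
    using inj_on_image_mem_iff[OF g v] sub by blast
  moreover have "inj_on ((`) g) {e \<in> E. v \<in> e}"
    using sub inj_on_image_eq_iff[OF g] by (auto intro!: inj_onI)
  ultimately show ?thesis by (simp add: degree_def card_image)
qed

lemma almost_regular_image:
  assumes R: "almost_regular W E n d" and g: "inj_on g W"
  shows "almost_regular (g ` W) ((`) g ` E) n d"
proof -
  have G: "graph W E" using R by (simp add: almost_regular_def)
  have "{v \<in> g ` W. degree ((`) g ` E) v \<noteq> d} = g ` {v \<in> W. degree E v \<noteq> d}"
    using degree_image[OF G g] by auto
  then have "card {v \<in> g ` W. degree ((`) g ` E) v \<noteq> d} \<le> card {v \<in> W. degree E v \<noteq> d}"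
    using card_image_le[of "{v \<in> W. degree E v \<noteq> d}" g] graph_finite_vertices[OF G] by simp
  then show ?thesis
    using R graph_image[OF G g] degree_image[OF G g] card_image[OF g]
    unfolding almost_regular_def by auto
qed

text \<open>An injection preserves the numbers of vertices and edges, and these characterise
  completeness.\<close>

lemma complete_graph_image:
  assumes "complete_graph W E" and g: "inj_on g W"
  shows "complete_graph (g ` W) ((`) g ` E)"
proof (rule complete_graphI)
  have G: "graph W E" using assms(1) by (rule complete_graph_graph)
  then show "graph (g ` W) ((`) g ` E)" using g by (rule graph_image)
  have "inj_on ((`) g) E"
    using graph_edge_subset[OF G] inj_on_image_eq_iff[OF g] by (auto intro!: inj_onI)
  then show "card (g ` W) * (card (g ` W) - 1) \<le> 2 * card ((`) g ` E)"
    using complete_graph_card_edges[OF assms(1)] card_image[OF g] by (simp add: card_image)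
qed

lemma iso_upto_isolated_image:
  assumes G: "graph W E" and g: "inj_on g W"
  shows "iso_upto_isolated E ((`) g ` E)"
  unfolding iso_upto_isolated_def
proof (intro exI conjI ballI)
  have UW: "\<Union>E \<subseteq> W" using graph_edge_subset[OF G] by blast
  show "bij_betw g (\<Union>E) (\<Union>((`) g ` E))"
    unfolding bij_betw_def using inj_on_subset[OF g UW] by (auto simp: image_Union)
  fix u v assume "u \<in> \<Union>E" "v \<in> \<Union>E"
  then have uv: "{u, v} \<subseteq> W" using UW by blast
  show "{u, v} \<in> E \<longleftrightarrow> {g u, g v} \<in> (`) g ` E"
  proof
    assume "{g u, g v} \<in> (`) g ` E"
    then obtain e where e: "e \<in> E" "g ` {u, v} = g ` e" by auto
    then have "{u, v} = e" using inj_on_image_eq_iff[OF g uv] graph_edge_subset[OF G] by blast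
    then show "{u, v} \<in> E" using e by simp
  next
    assume "{u, v} \<in> E"
    then have "g ` {u, v} \<in> (`) g ` E" by (rule imageI)
    then show "{g u, g v} \<in> (`) g ` E" by simp
  qed
qed

text \<open>The bijection between the non-isolated vertices induces one between the edges. This
  carries edge counts of the extremal graphs back to \<open>E\<close>.\<close>

lemma iso_upto_isolated_card:
  assumes G: "graph V E" and G': "graph V' E'" and "iso_upto_isolated E E'"
  shows "card E = card E'"
proof -
  obtain f where bij: "bij_betw f (\<Union>E) (\<Union>E')"
    and f: "\<And>u v. u \<in> \<Union>E \<Longrightarrow> v \<in> \<Union>E \<Longrightarrow> {u, v} \<in> E \<longleftrightarrow> {f u, f v} \<in> E'"
    using assms(3) unfolding iso_upto_isolated_def by blast
  have inj: "inj_on f (\<Union>E)" and im: "f ` \<Union>E = \<Union>E'" using bij by (auto simp: bij_betw_def)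
  have "(`) f ` E = E'"
  proof
    show "(`) f ` E \<subseteq> E'"
    proof
      fix e' assume "e' \<in> (`) f ` E"
      then obtain e where e: "e \<in> E" "e' = f ` e" by blast
      obtain u v where "e = {u, v}" using graph_edgeE[OF G e(1)] .
      then show "e' \<in> E'" using e f[of u v] by auto
    qed
    show "E' \<subseteq> (`) f ` E"
    proof
      fix e' assume e': "e' \<in> E'"
      obtain a b where ab: "e' = {a, b}" using graph_edgeE[OF G' e'] .
      then have "a \<in> f ` \<Union>E" "b \<in> f ` \<Union>E" using e' im by auto
      then obtain u v where uv: "u \<in> \<Union>E" "v \<in> \<Union>E" "a = f u" "b = f v" by blast
      then have "{u, v} \<in> E" using f[of u v] e' ab by simp
      moreover have "e' = f ` {u, v}" using ab uv by simp
      ultimately show "e' \<in> (`) f ` E" by blast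
    qed
  qed
  moreover have "inj_on ((`) f) E"
    using inj_on_image_eq_iff[OF inj] by (intro inj_onI) blast
  ultimately show ?thesis using card_image by metis
qed

section \<open>The extremal graphs\<close>

text \<open>With \<open>k = d + 1\<close>, both parity cases of \<open>g1\<close> become
  \<open>d * d + d / 2\<close> rounded down.\<close>

lemma g1_Suc: "g1 (Suc d) = real (d * d + d div 2)"
proof (cases "even d")
  case True
  then obtain j where "d = 2 * j" by blast
  then show ?thesis by (simp add: g1_def power2_eq_square algebra_simps)
next
  case False
  then obtain j where "d = 2 * j + 1" by (rule oddE)
  then show ?thesis by (simp add: g1_def power2_eq_square algebra_simps)
qed

lemma inj_to_nat: "finite W \<Longrightarrow> \<exists>g :: 'a \<Rightarrow> nat. inj_on g W"
  using finite_imp_inj_to_nat_seg by blast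

lemma card_edges_of_extremal:
  assumes G: "graph V E"
    and ext: "(\<exists>V' E'. almost_regular (V' :: 'b set) E' (2 * Suc d - 1) (Suc d - 1) \<and> iso_upto_isolated E E') \<or>
      (even (Suc d) \<and> (\<exists>V1 E1 V2 E2. (V1 :: 'b set) \<inter> V2 = {} \<and>
        almost_regular V1 E1 (Suc d + 1) (Suc d - 1) \<and> complete_graph V2 E2 \<and> card V2 = Suc d - 1 \<and>
        iso_upto_isolated E (E1 \<union> E2)))"
  shows "card E = d * d + d div 2"
  using ext
proof (elim disjE exE conjE)
  fix V' :: "'b set" and E'
  assume R: "almost_regular V' E' (2 * Suc d - 1) (Suc d - 1)" and "iso_upto_isolated E E'"
  then have "card E = card E'"
    using iso_upto_isolated_card[OF G] by (auto simp: almost_regular_def)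
  also have "\<dots> = (2 * (d * d) + d) div 2"
    using almost_regular_card_edges[OF R] by (simp add: algebra_simps)
  finally show ?thesis by simp
next
  fix V1 V2 :: "'b set" and E1 E2
  assume "even (Suc d)" and disj: "V1 \<inter> V2 = {}"
    and R: "almost_regular V1 E1 (Suc d + 1) (Suc d - 1)"
    and K: "complete_graph V2 E2" "card V2 = Suc d - 1" and iso: "iso_upto_isolated E (E1 \<union> E2)"
  then obtain j where j: "d = 2 * j + 1" by (auto elim: oddE)
  have G1: "graph V1 E1" and G2: "graph V2 E2"
    using R complete_graph_graph[OF K(1)] by (auto simp: almost_regular_def)
  have "graph (V1 \<union> V2) (E1 \<union> E2)"
    unfolding graph_def
  proof
    show "finite (V1 \<union> V2)" using graph_finite_vertices[OF G1] graph_finite_vertices[OF G2] by simp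
    show "\<forall>e\<in>E1 \<union> E2. \<exists>u v. u \<in> V1 \<union> V2 \<and> v \<in> V1 \<union> V2 \<and> u \<noteq> v \<and> e = {u, v}"
    proof
      fix e assume "e \<in> E1 \<union> E2"
      then obtain u v where "e = {u, v}" "u \<noteq> v" "u \<in> V1 \<union> V2" "v \<in> V1 \<union> V2"
        using graph_edgeE[OF G1, of e] graph_edgeE[OF G2, of e] by blast
      then show "\<exists>u v. u \<in> V1 \<union> V2 \<and> v \<in> V1 \<union> V2 \<and> u \<noteq> v \<and> e = {u, v}" by blast
    qed
  qed
  then have "card E = card (E1 \<union> E2)" using iso_upto_isolated_card[OF G] iso by blast
  moreover have "E1 \<inter> E2 = {}"
  proof (rule ccontr)
    assume "E1 \<inter> E2 \<noteq> {}"
    then obtain e where e: "e \<in> E1" "e \<in> E2" by blast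
    then have "e \<subseteq> V1 \<inter> V2" using graph_edge_subset G1 G2 by blast
    then show False using disj graph_edge_card[OF G1 e(1)] by simp
  qed
  ultimately have "card E = card E1 + card E2"
    using graph_finite_edges[OF G1] graph_finite_edges[OF G2] by (simp add: card_Un_disjoint)
  \<comment> \<open>This is \<open>(d + 2) * d div 2\<close> at \<open>d = 2 * j + 1\<close>, with
    the odd remainder split off so that the division evaluates.\<close>
  moreover have "card E1 = (2 * (2 * j * j + 4 * j + 1) + 1) div 2"
    using almost_regular_card_edges[OF R] j by (simp add: algebra_simps)
  moreover have "2 * card E2 = 2 * (2 * j * j + j)"
    using complete_graph_card_edges[OF K(1)] K(2) j by (simp add: algebra_simps)
  moreover have "d * d + d div 2 = 4 * j * j + 5 * j + 1" using j by (simp add: algebra_simps)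
  ultimately show ?thesis by simp
qed

theorem theorem1p3:
  fixes k :: nat and V :: "'a set" and E :: "'a set set"
  assumes "k \<ge> 1"
    and "graph V E"
    and "\<not> contains_subgraph (star_V k) (star_E k) V E"
    and "\<not> contains_subgraph (matching_V k) (matching_E k) V E"
    and "\<not> contains_subgraph (two_stars_V (k - 1)) (two_stars_E (k - 1)) V E"
  shows "real (card E) \<le> g1 k \<and>
    (real (card E) = g1 k \<longleftrightarrow>
      ((\<exists>(V' :: nat set) E'. almost_regular V' E' (2*k - 1) (k - 1) \<and> iso_upto_isolated E E') \<or>
       (even k \<and> (\<exists>(V1 :: nat set) E1 V2 E2. V1 \<inter> V2 = {} \<and>
           almost_regular V1 E1 (k + 1) (k - 1) \<and> complete_graph V2 E2 \<and> card V2 = k - 1 \<and>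
           iso_upto_isolated E (E1 \<union> E2)))))"
    (is "_ \<and> (_ \<longleftrightarrow> ?ext)")
proof -
  obtain d where k: "k = Suc d" using assms(1) by (cases k) auto
  note G = assms(2)
  have deg: "degree E v \<le> d" for v
    using contains_starI[OF G assms(1), of v] assms(3) k by (meson not_less_eq_eq)
  have nu: "\<forall>M. matching E M \<longrightarrow> card M \<le> d"
    using contains_matchingI[OF G, of _ k] assms(4) k by (meson not_less_eq_eq)
  have ns: "\<not> disjoint_stars E d" if "1 \<le> d"
    using contains_two_starsI[OF G that] assms(5) k by auto
  have finE: "finite E" using G by (rule graph_finite_edges)
  have "card E \<le> d * d + d div 2 \<and> (card E = d * d + d div 2 \<longrightarrow> ?ext)"
  proof -
    consider "d = 0" | "d = 1" | "2 \<le> d" by linarith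
    then show ?thesis
    proof cases
      case 1
      then have "E = {}" using degree_le_imp_card_edges_le[OF G deg] finE by simp
      \<comment> \<open>For \<open>k = 1\<close> the extremal graph R(1,0) is a single vertex, which
        agrees with the empty graph up to isolated vertices.\<close>
      moreover have "almost_regular {0::nat} {} (2*k - 1) (k - 1)"
        using k 1 by (simp add: almost_regular_def graph_def degree_def)
      moreover have "iso_upto_isolated ({} :: 'a set set) ({} :: nat set set)"
        by (simp add: iso_upto_isolated_def bij_betw_def)
      ultimately show ?thesis by auto
    next
      case 2
      have "card E \<le> 1"
        using card_edges_bounded_matching(1)[OF G _ deg nu ns] 2 by simp
      moreover have ?ext if "card E = 1"
      proof -
        obtain e where e: "E = {e}" using \<open>card E = 1\<close> by (rule card_1_singletonE)
        then obtain u v where uv: "e = {u, v}" "u \<noteq> v" using graph_edgeE[OF G, of e] by blast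
        let ?g = "\<lambda>x. if x = u then 0 else 1 :: nat"
        have "graph {u, v} E" using e uv by (auto simp: graph_def)
        moreover have "inj_on ?g {u, v}" using uv by (auto simp: inj_on_def)
        ultimately have "iso_upto_isolated E ((`) ?g ` E)" by (rule iso_upto_isolated_image)
        moreover have "(`) ?g ` E = {{0, 1}}" using e uv by auto
        ultimately have "iso_upto_isolated E {{0, 1 :: nat}}" by simp
        \<comment> \<open>R(3,1) is an edge together with an isolated deficient vertex. The label 2
          is new, since \<open>V\<close> itself may have only two vertices.\<close>
        moreover have "almost_regular {0, 1, 2 :: nat} {{0, 1}} (card {0, 1, 2 :: nat}) 1"
        proof (rule almost_regularI)
          show "graph {0, 1, 2 :: nat} {{0, 1}}" unfolding graph_def
            by (intro conjI ballI exI[of _ 0] exI[of _ 1]) auto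
          show "degree {{0, 1}} v \<le> 1" for v :: nat
            using card_mono[of "{{0, 1}}" "{e \<in> {{0, 1}}. v \<in> e}"] by (auto simp: degree_def)
        qed simp
        ultimately show ?thesis using k 2 by (intro disjI1) (auto simp: numeral_3_eq_3)
      qed
      ultimately show ?thesis using 2 by simp
    next
      case 3
      then have d: "1 \<le> d" by simp
      note core = card_edges_bounded_matching[OF G d deg nu ns[OF d]]
      have ?ext if "card E = d * d + d div 2"
        using core(2)[OF 3 that]
      proof (elim disjE exE conjE)
        fix B assume B: "B \<subseteq> V" and R: "almost_regular B E (2 * d + 1) d"
        then have "finite B" using graph_finite_vertices[OF G] finite_subset by blast
        then obtain g :: "'a \<Rightarrow> nat" where g: "inj_on g B" using inj_to_nat by blast
        have "graph B E" using R by (simp add: almost_regular_def)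
        then have "iso_upto_isolated E ((`) g ` E)" using g by (rule iso_upto_isolated_image)
        moreover have "almost_regular (g ` B) ((`) g ` E) (2 * k - 1) (k - 1)"
          using almost_regular_image[OF R g] k by simp
        ultimately show ?thesis by blast
      next
        fix B C assume "odd d" and B: "B \<subseteq> V" and C: "C \<subseteq> V" and disj: "B \<inter> C = {}"
          and R: "almost_regular B (induced E B) (d + 2) d"
          and K: "complete_graph C (induced E C)" "card C = d"
          and E: "E = induced E B \<union> induced E C"
        \<comment> \<open>One injection on all of \<open>V\<close> keeps the images of
          \<open>B\<close> and \<open>C\<close> disjoint.\<close>
        obtain g :: "'a \<Rightarrow> nat" where g: "inj_on g V"
          using inj_to_nat[OF graph_finite_vertices[OF G]] by blast
        have gB: "inj_on g B" and gC: "inj_on g C" using g B C inj_on_subset by blast+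
        have "(`) g ` E = (`) g ` induced E B \<union> (`) g ` induced E C"
          using E by (metis image_Un)
        then have "iso_upto_isolated E ((`) g ` induced E B \<union> (`) g ` induced E C)"
          using iso_upto_isolated_image[OF G g] by simp
        moreover have "g ` B \<inter> g ` C = {}" using disj g B C inj_on_image_Int[OF g B C] by simp
        moreover have "almost_regular (g ` B) ((`) g ` induced E B) (k + 1) (k - 1)"
          using almost_regular_image[OF R gB] k by simp
        moreover have "complete_graph (g ` C) ((`) g ` induced E C)"
          by (rule complete_graph_image[OF K(1) gC])
        moreover have "card (g ` C) = k - 1" using card_image[OF gC] K(2) k by simp
        moreover have "even k" using \<open>odd d\<close> k by simp
        ultimately show ?thesis by blast
      qed
      then show ?thesis using core(1) by blast
    qed
  qed
  moreover have "card E = d * d + d div 2" if ?ext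
    using that unfolding k by (rule card_edges_of_extremal[OF G])
  ultimately show ?thesis unfolding k g1_Suc of_nat_le_iff of_nat_eq_iff by blast
qed

end
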